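(* Let $f\colon\mathbb{R}^n\to\mathbb{R}$ be a locally Lipschitz path differentiable function, and let $\{x_i\}_{i\in\mathbb{N}}$ be a bounded sequence generated by the subgradient method with step sizes $\{\varepsilon_i\}_{i\in\mathbb{N}}$ and subgradients $v_i\in\partial^c f(x_i)$, i.e. $x_{i+1}=x_i-\varepsilon_i v_i$. Then: (i) (Lengthy separations) Let $x\neq y$ be two points of $\operatorname{ess\,acc}\{x_i\}_i$ with $f(x)\leq f(y)$. Let $\{x_{i_k}\}_k$ be a subsequence with $x_{i_k}\to x$ as $k\to+\infty$, and for each $k$ choose $i'_k>i_k$ such that $x_{i'_k}\to y$ as $k\to+\infty$. Put $\bar T_k=\sum_{p=i_k}^{i'_k}\varepsilon_p$. Then $\bar T_k\to+\infty$ as $k\to+\infty$. (ii) (Oscillation compensation) Let $\psi\colon\mathbb{R}^n\to[0,1]$ be a continuous function. Then for every subsequence $\{N_j\}_j\subset\mathbb{N}$ such that $$\liminf_{j\to+\infty}\frac{\sum_{i=0}^{N_j}\varepsilon_i\psi(x_i)}{\sum_{i=0}^{N_j}\varepsilon_i}>0,$$ we have $$\lim_{j\to+\infty}\frac{\sum_{i=0}^{N_j}\varepsilon_i v_i\psi(x_i)}{\sum_{i=0}^{N_j}\varepsilon_i\psi(x_i)}=0.$$ (iii) (Criticality) For all $x\in\operatorname{ess\,acc}\{x_i\}_i$ we have $0\in\partial^c f(x)$; in other words, $\operatorname{ess\,acc}\{x_i\}_i\subseteq\operatorname{crit} f$.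
   Context: **Clarke subdifferential.** For a locally Lipschitz $f\colon\mathbb{R}^n\to\mathbb{R}$, $\partial^c f(x)$ is the closed convex hull of the set of $v\in\mathbb{R}^n$ for which there is a sequence $y_k\to x$ of differentiability points of $f$ with $\nabla f(y_k)\to v$. The critical set is $\operatorname{crit} f=\{x\in\mathbb{R}^n: 0\in\partial^c f(x)\}$. **Path differentiability.** A locally Lipschitz function $f\colon\mathbb{R}^n\to\mathbb{R}$ is path differentiable if, for each Lipschitz curve $\gamma\colon\mathbb{R}\to\mathbb{R}^n$, for almost every $t\in\mathbb{R}$, $f\circ\gamma$ is differentiable at $t$ and $(f\circ\gamma)'(t)=v\cdot\gamma'(t)$ for all $v\in\partial^c f(\gamma(t))$. **Subgradient method.** $\{\varepsilon_i\}_{i\in\mathbb{N}}$ is a sequence of positive step sizes with $\sum_{i=0}^\infty\varepsilon_i=+\infty$ and $\varepsilon_i\searrow0$ (nonincreasing, converging to $0$). Given $x_0\in\mathbb{R}^n$, a subgradient sequence is any sequence with $x_{i+1}=x_i-\varepsilon_i v_i$, where $v_i$ is chosen freely in $\partial^c f(x_i)$, $i\geq0$. **Essential accumulation set.** $\operatorname{ess\,acc}\{x_i\}_i$ is the set of points $x\in\mathbb{R}^n$ such that, for every neighborhood $U\subseteq\mathbb{R}^n$ of $x$, $$\limsup_{N\to+\infty}\frac{\sum_{1\leq i\leq N,\ x_i\in U}\varepsilon_i}{\sum_{1\leq i\leq N}\varepsilon_i}>0.$$ *)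

theory Defs
  imports "HOL-Analysis.Analysis"
begin

text \<open>The library's \<^const>\<open>local_lipschitz\<close> concerns functions with an additional time parameter.\<close>

definition locally_lipschitz :: "('a::metric_space \<Rightarrow> 'b::metric_space) \<Rightarrow> bool"
  where "locally_lipschitz f \<longleftrightarrow> (\<forall>x. \<exists>r>0. \<exists>L. L-lipschitz_on (ball x r) f)"

definition clarke_subdifferential :: "('a::euclidean_space \<Rightarrow> real) \<Rightarrow> 'a \<Rightarrow> 'a set"
  where "clarke_subdifferential f x =
    closure (convex hull {v. \<exists>y g. y \<longlonglongrightarrow> x \<and> (\<forall>k. GDERIV f (y k) :> g k) \<and> g \<longlonglongrightarrow> v})"

definition crit :: "('a::euclidean_space \<Rightarrow> real) \<Rightarrow> 'a set"
  where "crit f = {x. 0 \<in> clarke_subdifferential f x}"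

text \<open>Since \<^const>\<open>vector_derivative\<close> and \<^const>\<open>deriv\<close> are total operators, differentiability of the
  curve and of the composition is stated explicitly. For the curve this costs nothing, because
  Lipschitz curves are differentiable almost everywhere.\<close>

definition path_differentiable :: "('a::euclidean_space \<Rightarrow> real) \<Rightarrow> bool"
  where "path_differentiable f \<longleftrightarrow>
    (\<forall>\<gamma> :: real \<Rightarrow> 'a. (\<exists>L. L-lipschitz_on UNIV \<gamma>) \<longrightarrow>
      (AE t in lebesgue.
         \<gamma> differentiable (at t) \<and> (f \<circ> \<gamma>) differentiable (at t) \<and>
         (\<forall>v \<in> clarke_subdifferential f (\<gamma> t).
            deriv (f \<circ> \<gamma>) t = v \<bullet> vector_derivative \<gamma> (at t))))"

definition step_sizes :: "(nat \<Rightarrow> real) \<Rightarrow> bool"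
  where "step_sizes \<epsilon> \<longleftrightarrow>
    (\<forall>i. 0 < \<epsilon> i) \<and> filterlim (\<lambda>N. \<Sum>i\<le>N. \<epsilon> i) at_top sequentially \<and> decseq \<epsilon> \<and> \<epsilon> \<longlonglongrightarrow> 0"

definition subgradient_sequence ::
    "('a::euclidean_space \<Rightarrow> real) \<Rightarrow> (nat \<Rightarrow> real) \<Rightarrow> (nat \<Rightarrow> 'a) \<Rightarrow> (nat \<Rightarrow> 'a) \<Rightarrow> bool"
  where "subgradient_sequence f \<epsilon> v x \<longleftrightarrow>
    (\<forall>i. v i \<in> clarke_subdifferential f (x i) \<and> x (Suc i) = x i - \<epsilon> i *\<^sub>R v i)"

text \<open>The limit superior is taken in \<^typ>\<open>ereal\<close>, as the reals are not a complete lattice.\<close>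

definition ess_acc :: "(nat \<Rightarrow> real) \<Rightarrow> (nat \<Rightarrow> 'a::topological_space) \<Rightarrow> 'a set"
  where "ess_acc \<epsilon> x =
    {a. \<forall>U. a \<in> interior U \<longrightarrow>
       0 < limsup (\<lambda>N. ereal ((\<Sum>i | 1 \<le> i \<and> i \<le> N \<and> x i \<in> U. \<epsilon> i) / (\<Sum>i=1..N. \<epsilon> i)))}"

end

theory Submission
  imports Defs "HOL-Complex_Analysis.Great_Picard"
begin

text \<open>Interpolate the iterates affinely in the time variable \<open>\<Sum>\<^sub>i \<epsilon>\<^sub>i\<close>. By upper semicontinuity of the
  Clarke subdifferential, limits of time-shifted interpolations are curves with
  \<open>- \<gamma>' \<in> \<partial>\<^sup>c f (\<gamma>)\<close> almost everywhere, and path differentiability gives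
  \<open>\<parallel>\<gamma> \<tau> - \<gamma> 0\<parallel>\<^sup>2 \<le> \<tau> (f (\<gamma> 0) - f (\<gamma> \<tau>))\<close>. By compactness the same inequality holds, up to an
  arbitrarily small error, for late iterates a bounded time apart. This gives (i) at once. For (ii),
  cut the time line into blocks of length about 1: the motion inside a block is controlled by the
  decrease of \<open>f\<close> across it, and these decreases telescope to a bounded quantity, so the weighted
  sum of the \<open>v\<^sub>i\<close> is \<open>o(\<Sum>\<^sub>i \<epsilon>\<^sub>i)\<close>. Applied to a bump function and a separating hyperplane, this
  estimate yields (iii).\<close>

subsection \<open>Clarke subdifferentials\<close>

text \<open>Differentiate along the ray in direction \<open>g\<close> itself: the slope there is
  \<open>g \<bullet> g\<close>, while the difference quotients are at most
  \<open>L * norm g\<close>.\<close>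

lemma gradient_norm_le:
  assumes lip: "L-lipschitz_on (ball a r) f" and y: "y \<in> ball a r" and D: "GDERIV f y :> g"
  shows "norm g \<le> L"
proof -
  have "((\<lambda>t. f (y + t *\<^sub>R g)) has_derivative (\<lambda>t. (t *\<^sub>R g) \<bullet> g)) (at 0)"
    by (rule has_derivative_compose[where f = "\<lambda>t. y + t *\<^sub>R g" and g = f])
      (use D in \<open>auto simp: gderiv_def intro!: derivative_eq_intros\<close>)
  then have "((\<lambda>t. f (y + t *\<^sub>R g)) has_field_derivative (g \<bullet> g)) (at 0)"
    unfolding has_field_derivative_def by (simp add: mult_commute_abs)
  then have lim: "((\<lambda>t. (f (y + t *\<^sub>R g) - f y) / t) \<longlongrightarrow> g \<bullet> g) (at 0)"
    by (simp add: DERIV_def)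
  have "((\<lambda>t. y + t *\<^sub>R g) \<longlongrightarrow> y + 0 *\<^sub>R g) (at (0::real))"
    by (intro tendsto_intros)
  then have "\<forall>\<^sub>F t in at (0::real). y + t *\<^sub>R g \<in> ball a r"
    by (rule topological_tendstoD[OF _ open_ball]) (use y in simp)
  moreover have "\<forall>\<^sub>F t in at (0::real). t \<noteq> 0"
    by (simp add: eventually_at_filter)
  ultimately have "\<forall>\<^sub>F t in at (0::real). (f (y + t *\<^sub>R g) - f y) / t \<le> L * norm g"
  proof eventually_elim
    case (elim t)
    have "\<bar>f (y + t *\<^sub>R g) - f y\<bar> \<le> L * norm (t *\<^sub>R g)"
      using lipschitz_onD[OF lip elim(1) y] by (simp add: dist_norm)
    then have "\<bar>(f (y + t *\<^sub>R g) - f y) / t\<bar> \<le> L * norm g"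
      using elim(2) by (simp add: abs_divide divide_le_eq mult_ac)
    then show ?case by linarith
  qed
  then have "g \<bullet> g \<le> L * norm g"
    using tendsto_upperbound[OF lim] by simp
  then show ?thesis
    using lipschitz_on_nonneg[OF lip]
    by (cases "g = 0") (auto simp: power2_norm_eq_inner[symmetric] power2_eq_square)
qed

lemma convex_clarke: "convex (clarke_subdifferential f x)"
  by (simp add: clarke_subdifferential_def convex_closure)

lemma closed_clarke: "closed (clarke_subdifferential f x)"
  by (simp add: clarke_subdifferential_def)

text \<open>Minimality of the closed convex hull; every upper bound on the subdifferential below
  goes through this rule.\<close>

lemma clarke_subset:
  assumes "\<And>y g u. \<lbrakk>y \<longlonglongrightarrow> x; \<And>k. GDERIV f (y k) :> g k; g \<longlonglongrightarrow> u\<rbrakk> \<Longrightarrow> u \<in> S"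
    and "closed S" "convex S"
  shows "clarke_subdifferential f x \<subseteq> S"
  unfolding clarke_subdifferential_def
  by (intro closure_minimal hull_minimal) (use assms in blast)+

lemma limiting_gradient_in_clarke:
  assumes "y \<longlonglongrightarrow> x" "\<And>k. GDERIV f (y k) :> g k" "g \<longlonglongrightarrow> u"
  shows "u \<in> clarke_subdifferential f x"
  unfolding clarke_subdifferential_def
  by (rule subsetD[OF closure_subset], rule hull_inc) (use assms in blast)

text \<open>A sequence tending to a point of the open ball is eventually inside it, so limiting
  gradients stay in the closed set \<open>S\<close>. Bounds on classical gradients thus carry over
  to Clarke subgradients.\<close>

lemma clarke_subset_if_gradients:
  assumes gr: "\<And>z g. \<lbrakk>z \<in> ball x r; GDERIV f z :> g\<rbrakk> \<Longrightarrow> g \<in> S"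
    and S: "closed S" "convex S" and y: "y \<in> ball x r"
  shows "clarke_subdifferential f y \<subseteq> S"
proof (rule clarke_subset[OF _ S])
  fix z g u assume z: "z \<longlonglongrightarrow> y" and g: "\<And>k. GDERIV f (z k) :> g k" and u: "g \<longlonglongrightarrow> u"
  have "\<forall>\<^sub>F k in sequentially. z k \<in> ball x r"
    by (rule topological_tendstoD[OF z open_ball y])
  then have "\<forall>\<^sub>F k in sequentially. g k \<in> S"
    by eventually_elim (use gr g in blast)
  with u S(1) show "u \<in> S"
    using Lim_in_closed_set trivial_limit_sequentially by blast
qed

lemma clarke_norm_le:
  assumes "L-lipschitz_on (ball a r) f" "y \<in> ball a r" "u \<in> clarke_subdifferential f y"
  shows "norm u \<le> L"
proof -
  have "clarke_subdifferential f y \<subseteq> cball 0 L"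
    by (rule clarke_subset_if_gradients[OF _ _ _ assms(2)])
      (use gradient_norm_le[OF assms(1)] in auto)
  with assms(3) show ?thesis by auto
qed

text \<open>Upper semicontinuity tested on one half-space, the form that fits separating
  hyperplanes. Gradients violating it at points tending to \<open>x\<close> are bounded, and a limit
  point \<open>u\<close> of them is a Clarke subgradient at \<open>x\<close> with
  \<open>w \<bullet> u \<le> c'\<close>; the gap \<open>c' < c\<close> makes this a
  contradiction.\<close>

lemma clarke_halfspace_usc:
  fixes f :: "'a::euclidean_space \<Rightarrow> real"
  assumes f: "locally_lipschitz f"
    and c: "\<And>u. u \<in> clarke_subdifferential f x \<Longrightarrow> c \<le> w \<bullet> u" and c': "c' < c"
  obtains r where "r > 0" "\<And>y u. \<lbrakk>y \<in> ball x r; u \<in> clarke_subdifferential f y\<rbrakk> \<Longrightarrow> c' \<le> w \<bullet> u"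
proof -
  obtain r0 L where r0: "r0 > 0" and lip: "L-lipschitz_on (ball x r0) f"
    using f unfolding locally_lipschitz_def by blast
  have "\<exists>r>0. \<forall>z\<in>ball x r. \<forall>g. GDERIV f z :> g \<longrightarrow> c' \<le> w \<bullet> g"
  proof (rule ccontr)
    assume "\<not> ?thesis"
    then have "\<forall>n. \<exists>z g. z \<in> ball x (min r0 (1 / Suc n)) \<and> GDERIV f z :> g \<and> w \<bullet> g < c'"
      using r0 by (metis (no_types, opaque_lifting) min_less_iff_conj not_le of_nat_0_less_iff zero_less_Suc zero_less_divide_1_iff)
    then obtain z g where z: "\<And>n. z n \<in> ball x (min r0 (1 / Suc n))"
      and g: "\<And>n. GDERIV f (z n) :> g n" and wg: "\<And>n. w \<bullet> g n < c'"
      by metis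
    have "norm (g n) \<le> L" for n
      using gradient_norm_le[OF lip _ g] z[of n] by simp
    then have "bounded (range g)"
      by (auto simp: bounded_iff)
    then obtain u k where k: "strict_mono (k :: nat \<Rightarrow> nat)" and gu: "(g \<circ> k) \<longlonglongrightarrow> u"
      using bounded_imp_convergent_subsequence by blast
    have "(\<lambda>n. dist (z n) x) \<longlonglongrightarrow> 0"
    proof (rule tendsto_sandwich[OF _ _ tendsto_const LIMSEQ_inverse_real_of_nat])
      show "\<forall>\<^sub>F n in sequentially. dist (z n) x \<le> inverse (real (Suc n))"
        using z by (intro always_eventually) (auto simp: dist_commute inverse_eq_divide less_imp_le)
    qed auto
    then have "z \<longlonglongrightarrow> x"
      by (rule tendsto_dist_iff[THEN iffD2])
    then have "(z \<circ> k) \<longlonglongrightarrow> x"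
      using k LIMSEQ_subseq_LIMSEQ by blast
    then have "u \<in> clarke_subdifferential f x"
      using limiting_gradient_in_clarke[OF _ _ gu] g by auto
    then have "c \<le> w \<bullet> u" by (rule c)
    moreover have "w \<bullet> u \<le> c'"
      by (rule tendsto_upperbound[OF tendsto_inner[OF tendsto_const gu]])
        (use wg in \<open>auto intro!: always_eventually less_imp_le\<close>)
    ultimately show False using c' by simp
  qed
  then obtain r where r: "r > 0" "\<And>z g. \<lbrakk>z \<in> ball x r; GDERIV f z :> g\<rbrakk> \<Longrightarrow> c' \<le> w \<bullet> g"
    by blast
  have "clarke_subdifferential f y \<subseteq> {u. c' \<le> w \<bullet> u}" if "y \<in> ball x r" for y
    by (rule clarke_subset_if_gradients[OF _ _ _ that])
      (use r(2) in \<open>auto simp: closed_halfspace_ge convex_halfspace_ge\<close>)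
  with r(1) that show thesis by blast
qed

lemma clarke_bounded_on_bounded:
  fixes f :: "'a::euclidean_space \<Rightarrow> real"
  assumes f: "locally_lipschitz f" and S: "bounded S"
  obtains B where "B > 0" "\<And>y u. \<lbrakk>y \<in> S; u \<in> clarke_subdifferential f y\<rbrakk> \<Longrightarrow> norm u \<le> B"
proof -
  obtain r L where r: "\<And>z. r z > 0" and L: "\<And>z. (L z)-lipschitz_on (ball z (r z)) f"
    using f unfolding locally_lipschitz_def by metis
  have "closure S \<subseteq> (\<Union>z\<in>UNIV. ball z (r z))"
    using r by (meson UN_I UNIV_I centre_in_ball subsetI)
  then obtain K where K: "finite K" "closure S \<subseteq> (\<Union>z\<in>K. ball z (r z))"
    using compactE_image[of "closure S" UNIV "\<lambda>z. ball z (r z)"] S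
    by (metis compact_closure open_ball)
  show thesis
  proof
    show "(1 + (\<Sum>z\<in>K. L z)) > 0"
      \<comment> \<open>The sum dominates each local constant; adding 1 keeps the bound positive
        even if \<open>K\<close> is empty or all constants vanish.\<close>
      using L lipschitz_on_nonneg by (metis add_pos_nonneg sum_nonneg zero_less_one)
    fix y u assume "y \<in> S" "u \<in> clarke_subdifferential f y"
    then obtain z where z: "z \<in> K" "norm u \<le> L z"
      using K(2) closure_subset clarke_norm_le[OF L] by blast
    then have "norm u \<le> (\<Sum>z\<in>K. L z)"
      using member_le_sum[of z K L] K(1) L lipschitz_on_nonneg by fastforce
    then show "norm u \<le> 1 + (\<Sum>z\<in>K. L z)" by simp
  qed
qed

lemma locally_lipschitz_isCont:
  assumes "locally_lipschitz f"
  shows "isCont f x"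
proof -
  obtain r L where "r > 0" "L-lipschitz_on (ball x r) f"
    using assms unfolding locally_lipschitz_def by blast
  then show ?thesis
    using lipschitz_on_continuous_on continuous_on_interior by (metis centre_in_ball interior_open open_ball)
qed

subsection \<open>Descent along subgradient curves\<close>

text \<open>If \<open>h a < h b\<close>, some value in between avoids the null set \<open>h ` N\<close>; where it is attained for the
  last time, the derivative of \<open>h\<close> would have to be nonnegative.\<close>

lemma deriv_neg_off_negligible_imp_le:
  fixes h :: "real \<Rightarrow> real"
  assumes ab: "a \<le> b" and lip: "locally_lipschitz h"
    and neg: "negligible N"
    and D: "\<And>t. \<lbrakk>a < t; t < b; t \<notin> N\<rbrakk> \<Longrightarrow> \<exists>d<0. (h has_real_derivative d) (at t)"
  shows "h b \<le> h a"
proof (rule ccontr)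
  assume "\<not> h b \<le> h a"
  then have lt: "h a < h b" by simp
  \<comment> \<open>Lipschitz maps preserve null sets. A merely continuous \<open>h\<close> could
    climb on \<open>N\<close>, as the Cantor function does.\<close>
  have "negligible (h ` N)"
  proof (rule negligible_locally_Lipschitz_image[OF _ neg])
    fix t
    obtain r L where "r > 0" and L: "L-lipschitz_on (ball t r) h"
      using lip unfolding locally_lipschitz_def by blast
    then show "\<exists>T B. open T \<and> t \<in> T \<and> (\<forall>y\<in>N \<inter> T. norm (h y - h t) \<le> B * norm (y - t))"
      by (intro exI[of _ "ball t r"] exI[of _ L]) (use lipschitz_on_normD[OF L] in \<open>auto\<close>)
  qed simp
  moreover have "\<not> negligible {h a<..<h b}"
    using lt by (simp add: open_not_negligible)
  ultimately obtain y where y: "h a < y" "y < h b" "y \<notin> h ` N"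
    using negligible_subset by (metis greaterThanLessThan_iff subsetI)
  have cont: "continuous_on {a..b} h"
    using lip locally_lipschitz_isCont continuous_at_imp_continuous_on by blast
  define A where "A = {a..b} \<inter> h -` {..y}"
  have "closed A"
    unfolding A_def using cont by (intro continuous_closed_preimage) auto
  moreover have "bounded A" unfolding A_def by (meson bounded_Int bounded_closed_interval)
  ultimately have cA: "compact A" using compact_eq_bounded_closed by blast
  have "a \<in> A" using ab y by (auto simp: A_def)
  then obtain t where t: "t \<in> A" and tmax: "\<And>s. s \<in> A \<Longrightarrow> s \<le> t"
    using compact_attains_sup[OF cA] by blast
  have after: "y < h s" if "t < s" "s \<le> b" for s
    using that t tmax[of s] by (force simp: A_def)
  have tb: "t < b" using t y by (auto simp: A_def less_le)
  have hty: "h t = y"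
  proof (rule antisym)
    show "h t \<le> y" using t by (simp add: A_def)
    have "(h \<longlongrightarrow> h t) (at_right t)"
      using locally_lipschitz_isCont[OF lip, of t] by (simp add: isCont_def filterlim_at_split)
    moreover have "\<forall>\<^sub>F s in at_right t. y \<le> h s"
      using after tb by (intro eventually_at_right_less[THEN eventually_mono] eventually_at_rightI[of t b]) force+
    ultimately show "y \<le> h t"
      by (rule tendsto_lowerbound) simp
  qed
  have "t \<noteq> a" using hty y by auto
  then have "a < t" using t by (auto simp: A_def)
  moreover have "t \<notin> N" using y hty by auto
  ultimately obtain d where d: "d < 0" "(h has_real_derivative d) (at t)"
    using D tb by blast
  obtain e where e: "e > 0" "\<And>s. 0 < s \<Longrightarrow> s < e \<Longrightarrow> h (t + s) < h t"
    using DERIV_neg_dec_right[OF d(2,1)] by blast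
  define s where "s = min (e / 2) (b - t)"
  have "0 < s" "s < e" "t + s \<le> b" using e tb by (auto simp: s_def)
  then show False
    using e(2)[of s] after[of "t + s"] hty by auto
qed

section \<open>Stability of local Lipschitz continuity under composition and addition\<close>

lemma locally_lipschitz_compose:
  fixes f :: "'b::metric_space \<Rightarrow> 'c::metric_space"
  assumes f: "locally_lipschitz f" and g: "L-lipschitz_on UNIV g"
  shows "locally_lipschitz (f \<circ> g)"
  unfolding locally_lipschitz_def
proof
  fix t
  obtain r M where r: "r > 0" and M: "M-lipschitz_on (ball (g t) r) f"
    using f unfolding locally_lipschitz_def by blast
  have L: "L \<ge> 0" using g lipschitz_on_nonneg by blast
  \<comment> \<open>Dividing by \<open>L + 1\<close> avoids a zero denominator and makes
    \<open>L * \<rho> < r\<close> strict.\<close>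
  define \<rho> where "\<rho> = r / (L + 1)"
  have \<rho>: "\<rho> > 0" using r L by (simp add: \<rho>_def)
  have "g ` ball t \<rho> \<subseteq> ball (g t) r"
  proof clarsimp
    fix s assume s: "dist t s < \<rho>"
    have "dist (g t) (g s) \<le> L * dist t s"
      using lipschitz_onD[OF g] by simp
    also have "\<dots> \<le> L * \<rho>"
      using L s by (simp add: mult_left_mono)
    also have "\<dots> < r"
      using r L by (simp add: \<rho>_def divide_simps algebra_simps)
    finally show "dist (g t) (g s) < r" .
  qed
  then have "(M * L)-lipschitz_on (ball t \<rho>) (f \<circ> g)"
    using lipschitz_on_compose lipschitz_on_subset M g by (metis subset_UNIV)
  with \<rho> show "\<exists>r>0. \<exists>L. L-lipschitz_on (ball t r) (f \<circ> g)" by blast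
qed

lemma locally_lipschitz_add_lipschitz:
  fixes f g :: "'b::metric_space \<Rightarrow> 'c::real_normed_vector"
  assumes f: "locally_lipschitz f" and g: "L-lipschitz_on UNIV g"
  shows "locally_lipschitz (\<lambda>t. f t + g t)"
  unfolding locally_lipschitz_def
proof
  fix t
  obtain r M where "r > 0" "M-lipschitz_on (ball t r) f"
    using f unfolding locally_lipschitz_def by blast
  then show "\<exists>r>0. \<exists>L. L-lipschitz_on (ball t r) (\<lambda>t. f t + g t)"
    using lipschitz_on_add lipschitz_on_subset[OF g subset_UNIV] by blast
qed

text \<open>Along a descent curve \<open>(f \<circ> \<gamma>)' = - \<parallel>\<gamma>'\<parallel>\<^sup>2\<close>. Integrating this and applying Cauchy-Schwarz
  is avoided by comparing with the constant velocity \<open>w = (\<gamma> \<tau> - \<gamma> 0) / \<tau>\<close>: the function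
  \<open>f \<circ> \<gamma> + 2 w \<bullet> \<gamma> - (\<parallel>w\<parallel>\<^sup>2 + e) t\<close> has derivative \<open>- \<parallel>\<gamma>' - w\<parallel>\<^sup>2 - e\<close>.\<close>

lemma subgradient_curve_descent:
  fixes f :: "'a::euclidean_space \<Rightarrow> real"
  assumes f: "locally_lipschitz f" and pd: "path_differentiable f"
    and \<gamma>: "L-lipschitz_on UNIV \<gamma>" and \<tau>: "\<tau> \<ge> 0"
    and curve: "\<And>t d. \<lbrakk>0 < t; t < \<tau>; (\<gamma> has_vector_derivative d) (at t)\<rbrakk>
                  \<Longrightarrow> - d \<in> clarke_subdifferential f (\<gamma> t)"
  shows "(norm (\<gamma> \<tau> - \<gamma> 0))\<^sup>2 \<le> \<tau> * (f (\<gamma> 0) - f (\<gamma> \<tau>))"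
proof (cases "\<tau> = 0")
  case False
  with \<tau> have \<tau>: "\<tau> > 0" by simp
  define w where "w = (\<gamma> \<tau> - \<gamma> 0) /\<^sub>R \<tau>"
  have w: "\<gamma> \<tau> - \<gamma> 0 = \<tau> *\<^sub>R w" using \<tau> by (simp add: w_def)
  from pd \<gamma> have "AE t in lebesgue.
         \<gamma> differentiable (at t) \<and> (f \<circ> \<gamma>) differentiable (at t) \<and>
         (\<forall>v \<in> clarke_subdifferential f (\<gamma> t).
            deriv (f \<circ> \<gamma>) t = v \<bullet> vector_derivative \<gamma> (at t))"
    unfolding path_differentiable_def by blast
  then obtain N where N: "N \<in> null_sets lebesgue"
    and D: "\<And>t. t \<notin> N \<Longrightarrow> \<gamma> differentiable (at t) \<and> (f \<circ> \<gamma>) differentiable (at t) \<and>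
         (\<forall>v \<in> clarke_subdifferential f (\<gamma> t).
            deriv (f \<circ> \<gamma>) t = v \<bullet> vector_derivative \<gamma> (at t))"
    unfolding eventually_ae_filter by auto
  have "(w \<bullet> w) * \<tau> \<le> f (\<gamma> 0) - f (\<gamma> \<tau>) + \<delta>" if \<delta>: "\<delta> > 0" for \<delta>
  proof -
    \<comment> \<open>The term in \<open>e\<close> makes the derivative of \<open>h\<close> strictly
      negative and costs exactly \<open>\<delta>\<close> over the whole interval.\<close>
    define e where "e = \<delta> / \<tau>"
    have e: "e > 0" using \<delta> \<tau> by (simp add: e_def)
    define h where "h = (\<lambda>t. (f \<circ> \<gamma>) t + (2 * (w \<bullet> \<gamma> t) - (w \<bullet> w + e) * t))"
    have "(2 * (norm w * L) + \<bar>w \<bullet> w + e\<bar>)-lipschitz_on UNIV (\<lambda>t. 2 * (w \<bullet> \<gamma> t) - (w \<bullet> w + e) * t)"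
    proof (rule lipschitz_onI)
      fix s t :: real
      have "\<bar>w \<bullet> (\<gamma> s - \<gamma> t)\<bar> \<le> norm w * norm (\<gamma> s - \<gamma> t)"
        by (rule Cauchy_Schwarz_ineq2)
      also have "\<dots> \<le> norm w * (L * \<bar>s - t\<bar>)"
        using lipschitz_on_normD[OF \<gamma>, of s t] by (simp add: mult_left_mono)
      finally have "\<bar>2 * (w \<bullet> (\<gamma> s - \<gamma> t))\<bar> \<le> 2 * (norm w * L) * \<bar>s - t\<bar>"
        by (simp add: mult_ac)
      moreover have "\<bar>(w \<bullet> w + e) * (s - t)\<bar> = \<bar>w \<bullet> w + e\<bar> * \<bar>s - t\<bar>"
        by (simp add: abs_mult)
      ultimately have "\<bar>2 * (w \<bullet> (\<gamma> s - \<gamma> t)) - (w \<bullet> w + e) * (s - t)\<bar>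
          \<le> (2 * (norm w * L) + \<bar>w \<bullet> w + e\<bar>) * \<bar>s - t\<bar>"
        unfolding distrib_right by linarith
      then show "dist (2 * (w \<bullet> \<gamma> s) - (w \<bullet> w + e) * s) (2 * (w \<bullet> \<gamma> t) - (w \<bullet> w + e) * t)
          \<le> (2 * (norm w * L) + \<bar>w \<bullet> w + e\<bar>) * dist s t"
        by (simp add: dist_real_def inner_diff_right algebra_simps)
    qed (use lipschitz_on_nonneg[OF \<gamma>] in simp)
    then have "locally_lipschitz h"
      unfolding h_def by (intro locally_lipschitz_add_lipschitz locally_lipschitz_compose[OF f \<gamma>])
    then have "h \<tau> \<le> h 0"
    proof (rule deriv_neg_off_negligible_imp_le[rotated])
      show "negligible N" using N by (simp add: negligible_iff_null_sets)
      fix t assume t: "0 < t" "t < \<tau>" "t \<notin> N"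
      define d where "d = vector_derivative \<gamma> (at t)"
      have d: "(\<gamma> has_vector_derivative d) (at t)"
        using D[OF t(3)] by (simp add: d_def vector_derivative_works)
      \<comment> \<open>Path differentiability allows any subgradient at the point;
        \<open>- d\<close> is one by the curve hypothesis.\<close>
      have "deriv (f \<circ> \<gamma>) t = (- d) \<bullet> d"
        using D[OF t(3)] curve[OF t(1,2) d] unfolding d_def by blast
      then have fd: "((f \<circ> \<gamma>) has_real_derivative (- d) \<bullet> d) (at t)"
        using D[OF t(3)] by (metis DERIV_deriv_iff_real_differentiable)
      have "((\<lambda>t. w \<bullet> \<gamma> t) has_real_derivative w \<bullet> d) (at t)"
        using bounded_linear.has_vector_derivative[OF bounded_linear_inner_right d]
        by (simp add: has_real_derivative_iff_has_vector_derivative)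
      then have "(h has_real_derivative ((- d) \<bullet> d + (2 * (w \<bullet> d) - (w \<bullet> w + e) * 1))) (at t)"
        unfolding h_def by (intro DERIV_add fd DERIV_diff DERIV_cmult DERIV_ident)
      moreover have "(- d) \<bullet> d + (2 * (w \<bullet> d) - (w \<bullet> w + e) * 1) = - ((d - w) \<bullet> (d - w)) - e"
        by (simp add: inner_diff inner_commute)
      moreover have "\<dots> < 0"
        using e inner_ge_zero[of "d - w"] by linarith
      ultimately show "\<exists>d<0. (h has_real_derivative d) (at t)" by metis
    qed (use \<tau> in simp)
    moreover have "w \<bullet> \<gamma> \<tau> - w \<bullet> \<gamma> 0 = (w \<bullet> w) * \<tau>"
      using w by (metis inner_diff_right inner_scaleR_right mult.commute)
    moreover have "e * \<tau> = \<delta>" using \<tau> by (simp add: e_def)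
    ultimately show ?thesis
      by (simp add: h_def algebra_simps)
  qed
  then have "(w \<bullet> w) * \<tau> \<le> f (\<gamma> 0) - f (\<gamma> \<tau>)"
    by (rule field_le_epsilon)
  then have "\<tau> * ((w \<bullet> w) * \<tau>) \<le> \<tau> * (f (\<gamma> 0) - f (\<gamma> \<tau>))"
    using \<tau> by (simp add: mult_left_mono)
  then show ?thesis
    unfolding w power2_norm_eq_inner by (simp add: mult_ac)
qed simp

subsection \<open>Interpolated subgradient sequences\<close>

locale bounded_subgradient_method =
  fixes f :: "'a::euclidean_space \<Rightarrow> real" and \<epsilon> :: "nat \<Rightarrow> real" and v x :: "nat \<Rightarrow> 'a"
  assumes f_lipschitz: "locally_lipschitz f"
    and f_path_diff: "path_differentiable f"
    and steps: "step_sizes \<epsilon>"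
    and iteration: "subgradient_sequence f \<epsilon> v x"
    and bounded_x: "bounded (range x)"
begin

lemma step_pos: "0 < \<epsilon> i"
  using steps by (simp add: step_sizes_def)

lemma step_antimono: "i \<le> j \<Longrightarrow> \<epsilon> j \<le> \<epsilon> i"
  using steps by (simp add: step_sizes_def decseqD)

lemma step_tendsto: "\<epsilon> \<longlonglongrightarrow> 0"
  using steps by (simp add: step_sizes_def)

lemma v_in: "v i \<in> clarke_subdifferential f (x i)"
  using iteration by (simp add: subgradient_sequence_def)

lemma x_Suc: "x (Suc i) = x i - \<epsilon> i *\<^sub>R v i"
  using iteration by (simp add: subgradient_sequence_def)

text \<open>One bound on all subgradients, fixed for the whole locale; it will be a Lipschitz
  constant of every interpolation.\<close>

definition "speed = (SOME B. B > 0 \<and> (\<forall>i. norm (v i) \<le> B))"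

lemma speed: "speed > 0" "norm (v i) \<le> speed"
proof -
  obtain B where "B > 0" "\<And>i. norm (v i) \<le> B"
    using clarke_bounded_on_bounded[OF f_lipschitz bounded_x] v_in by (metis rangeI)
  then have "speed > 0 \<and> (\<forall>i. norm (v i) \<le> speed)"
    unfolding speed_def by (intro someI[of "\<lambda>B. B > 0 \<and> (\<forall>i. norm (v i) \<le> B)"]) auto
  then show "speed > 0" "norm (v i) \<le> speed" by auto
qed

text \<open>The starting time of step \<open>n\<close>, which occupies the interval from
  \<open>elapsed n\<close> to \<open>elapsed (Suc n)\<close>.\<close>

definition "elapsed n = (\<Sum>i<n. \<epsilon> i)"

lemma elapsed_Suc: "elapsed (Suc n) = elapsed n + \<epsilon> n"
  by (simp add: elapsed_def)

lemma elapsed_less: "m < n \<Longrightarrow> elapsed m < elapsed n"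
  by (rule lift_Suc_mono_less[of elapsed]) (simp add: elapsed_Suc step_pos)

lemma elapsed_le: "m \<le> n \<Longrightarrow> elapsed m \<le> elapsed n"
  by (metis elapsed_less order_le_less)

lemma elapsed_nonneg: "0 \<le> elapsed n"
  using elapsed_le[of 0 n] by (simp add: elapsed_def)

lemma elapsed_diff: "m \<le> n \<Longrightarrow> (\<Sum>p=m..<n. \<epsilon> p) = elapsed n - elapsed m"
  unfolding elapsed_def lessThan_atLeast0 by (simp add: sum_diff_nat_ivl)

text \<open>The part of step \<open>i\<close> that is completed at time \<open>t\<close>. Interpolating with these weights makes every
  difference of two interpolated points a nonnegative combination of the \<open>v i\<close>.\<close>

definition "portion i t = max 0 (min (t - elapsed i) (\<epsilon> i))"

lemma portion_mono: "s \<le> t \<Longrightarrow> portion i s \<le> portion i t"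
  by (auto simp: portion_def)

text \<open>The steps fill consecutive time intervals, so their completed portions add up to the
  time \<open>t\<close>, truncated to the range covered by the first \<open>n\<close> steps.\<close>

lemma sum_portion: "(\<Sum>i<n. portion i t) = max 0 (min t (elapsed n))"
proof (induction n)
  case (Suc n)
  then show ?case
    using step_pos[of n] elapsed_nonneg[of n] by (auto simp: portion_def elapsed_Suc max_def min_def)
qed (simp add: elapsed_def)

lemma portion_active:
  assumes "portion i s < portion i t"
  shows "elapsed i < t" "s < elapsed (Suc i)"
  using assms step_pos[of i] by (auto simp: portion_def elapsed_Suc max_def min_def split: if_splits)

text \<open>Only the first \<open>n\<close> steps move the curve: it is constant before time 0 and
  after \<open>elapsed n\<close>, hence a curve on the whole real line given by a finite
  sum.\<close>

definition "interp n t = x 0 - (\<Sum>i<n. portion i t *\<^sub>R v i)"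

lemma interp_elapsed: "m \<le> n \<Longrightarrow> interp n (elapsed m) = x m"
proof -
  assume mn: "m \<le> n"
  have p: "portion i (elapsed m) = (if i < m then \<epsilon> i else 0)" for i
    using elapsed_le[of "Suc i" m] elapsed_le[of m i] step_pos[of i]
    by (cases "i < m") (auto simp: portion_def elapsed_Suc)
  have "(\<Sum>i<n. portion i (elapsed m) *\<^sub>R v i) = (\<Sum>i<n. if i < m then \<epsilon> i *\<^sub>R v i else 0)"
    by (intro sum.cong) (auto simp: p)
  also have "\<dots> = (\<Sum>i<m. \<epsilon> i *\<^sub>R v i)"
    using mn by (subst sum.If_cases) (auto intro!: sum.cong)
  also have "\<dots> = x 0 - x m"
    by (induction m) (auto simp: x_Suc)
  finally show ?thesis by (simp add: interp_def)
qed

lemma interp_diff: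
  "interp n s - interp n t = (\<Sum>i<n. (portion i t - portion i s) *\<^sub>R v i)"
  by (simp add: interp_def scaleR_left_diff_distrib sum_subtractf)

lemma sum_portion_diff_le:
  "s \<le> t \<Longrightarrow> (\<Sum>i<n. portion i t - portion i s) \<le> t - s"
  unfolding sum_subtractf sum_portion by auto

lemma interp_lipschitz: "speed-lipschitz_on UNIV (interp n)"
proof (rule lipschitz_on_leI)
  fix s t :: real assume st: "s \<le> t"
  have "dist (interp n s) (interp n t) \<le> (\<Sum>i<n. norm ((portion i t - portion i s) *\<^sub>R v i))"
    unfolding dist_norm interp_diff by (rule norm_sum)
  also have "\<dots> \<le> (\<Sum>i<n. (portion i t - portion i s) * speed)"
    by (intro sum_mono) (use st portion_mono speed in \<open>auto intro!: mult_left_mono\<close>)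
  also have "\<dots> = (\<Sum>i<n. portion i t - portion i s) * speed"
    by (simp add: sum_distrib_right)
  also have "\<dots> \<le> (t - s) * speed"
    using sum_portion_diff_le[OF st] speed(1) by (simp add: mult_right_mono)
  finally show "dist (interp n s) (interp n t) \<le> speed * dist s t"
    using st by (simp add: dist_real_def mult.commute)
qed (use speed in simp)

text \<open>Inside the covered time range the weights sum to exactly \<open>t - s\<close>, so the
  displacement is \<open>t - s\<close> times an average of the active \<open>v i\<close>. Exactness
  matters because \<open>c\<close> may have either sign.\<close>

lemma interp_halfspace:
  assumes st: "0 \<le> s" "s \<le> t" "t \<le> elapsed n"
    and c: "\<And>i. \<lbrakk>i < n; portion i s < portion i t\<rbrakk> \<Longrightarrow> c \<le> w \<bullet> v i"
  shows "c * (t - s) \<le> w \<bullet> (interp n s - interp n t)"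
proof -
  have "c * (t - s) = (\<Sum>i<n. (portion i t - portion i s) * c)"
    using st unfolding sum_distrib_right[symmetric] sum_subtractf sum_portion by simp
  also have "\<dots> \<le> (\<Sum>i<n. (portion i t - portion i s) * (w \<bullet> v i))"
  proof (rule sum_mono)
    fix i assume "i \<in> {..<n}"
    then show "(portion i t - portion i s) * c \<le> (portion i t - portion i s) * (w \<bullet> v i)"
      using c[of i] portion_mono[OF st(2), of i]
      by (cases "portion i s < portion i t") (auto intro: mult_left_mono)
  qed
  also have "\<dots> = w \<bullet> (interp n s - interp n t)"
    by (simp add: interp_diff inner_sum_right)
  finally show ?thesis .
qed

text \<open>Otherwise a hyperplane strictly separates \<open>- d\<close> from the subdifferential at
  \<open>\<gamma> t\<close>. By semicontinuity every subgradient used shortly after time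
  \<open>t\<close> lies on the far side, so \<open>w \<bullet> \<gamma>\<close> falls at rate at
  least \<open>c'\<close>, which contradicts the velocity \<open>d\<close>.\<close>

lemma limit_curve_velocity:
  fixes i j :: "nat \<Rightarrow> nat" and \<gamma> :: "real \<Rightarrow> 'a"
  assumes i: "filterlim i at_top sequentially"
    and \<tau>: "(\<lambda>k. elapsed (j k) - elapsed (i k)) \<longlonglongrightarrow> \<tau>"
    and lim: "\<And>s. \<lbrakk>0 \<le> s; s \<le> \<tau>\<rbrakk> \<Longrightarrow> (\<lambda>k. interp (j k) (elapsed (i k) + s)) \<longlonglongrightarrow> \<gamma> s"
    and t: "0 < t" "t < \<tau>" and d: "(\<gamma> has_vector_derivative d) (at t)"
  shows "- d \<in> clarke_subdifferential f (\<gamma> t)"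
proof (rule ccontr)
  assume "- d \<notin> clarke_subdifferential f (\<gamma> t)"
  then obtain w c where wd: "w \<bullet> (- d) < c"
    and wu: "\<And>u. u \<in> clarke_subdifferential f (\<gamma> t) \<Longrightarrow> c < w \<bullet> u"
    using separating_hyperplane_closed_point[OF convex_clarke closed_clarke] by blast
  obtain c' where c': "w \<bullet> (- d) < c'" "c' < c"
    using dense[OF wd] by blast
  obtain r where r: "r > 0"
    "\<And>y u. \<lbrakk>y \<in> ball (\<gamma> t) r; u \<in> clarke_subdifferential f y\<rbrakk> \<Longrightarrow> c' \<le> w \<bullet> u"
    using clarke_halfspace_usc[OF f_lipschitz less_imp_le[OF wu] c'(2)] by blast
  \<comment> \<open>In time \<open>\<delta>\<close> an interpolation moves at most
    \<open>r / 2\<close>; the other half of \<open>r\<close> is left for the distance from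
    \<open>X k t\<close> to \<open>\<gamma> t\<close>.\<close>
  define \<delta> where "\<delta> = r / (2 * speed)"
  have \<delta>: "\<delta> > 0" "speed * \<delta> = r / 2" using r speed(1) by (auto simp: \<delta>_def)
  have step: "c' * h \<le> w \<bullet> (\<gamma> t - \<gamma> (t + h))" if h: "0 < h" "h < \<delta>" "t + h < \<tau>" for h
  proof -
    define X where "X = (\<lambda>k s. interp (j k) (elapsed (i k) + s))"
    have "\<forall>\<^sub>F k in sequentially. \<epsilon> (i k) < \<delta>"
      using order_tendstoD(2)[OF filterlim_compose[OF step_tendsto i] \<delta>(1)] .
    moreover have "\<forall>\<^sub>F k in sequentially. t + h < elapsed (j k) - elapsed (i k)"
      using order_tendstoD(1)[OF \<tau> h(3)] .
    moreover have lt: "(\<lambda>k. X k t) \<longlonglongrightarrow> \<gamma> t"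
      using lim[of t] t by (simp add: X_def)
    then have "\<forall>\<^sub>F k in sequentially. dist (X k t) (\<gamma> t) < r / 2"
      by (rule tendstoD) (use r in simp)
    ultimately have "\<forall>\<^sub>F k in sequentially. c' * h \<le> w \<bullet> (X k t - X k (t + h))"
    proof eventually_elim
      case (elim k)
      have "c' * ((elapsed (i k) + (t + h)) - (elapsed (i k) + t)) \<le> w \<bullet> (X k t - X k (t + h))"
        unfolding X_def
      proof (rule interp_halfspace)
        fix p assume p: "p < j k"
          and act: "portion p (elapsed (i k) + t) < portion p (elapsed (i k) + (t + h))"
        have a: "elapsed p < elapsed (i k) + (t + h)" "elapsed (i k) + t < elapsed (Suc p)"
          using portion_active[OF act] .
        \<comment> \<open>An active step is not earlier than \<open>i k\<close>, hence no longer
          than \<open>\<epsilon> (i k)\<close>. Even if already under way at the start of the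
          window, it began less than \<open>\<delta>\<close> before.\<close>
        have "elapsed (i k) < elapsed (Suc p)" using a t by linarith
        then have "i k \<le> p" using elapsed_le[of "Suc p" "i k"] by linarith
        then have "\<epsilon> p < \<delta>" using step_antimono elim(1) by (meson order.strict_trans1)
        then have ab: "\<bar>elapsed p - (elapsed (i k) + t)\<bar> < \<delta>"
          using a h unfolding elapsed_Suc by linarith
        have "dist (x p) (X k t) \<le> speed * \<bar>elapsed p - (elapsed (i k) + t)\<bar>"
          using lipschitz_onD[OF interp_lipschitz, of "elapsed p" "elapsed (i k) + t" "j k"] p
          by (simp add: X_def interp_elapsed dist_real_def)
        also have "\<dots> < r / 2"
          unfolding \<delta>(2)[symmetric] using ab speed(1) by (simp add: mult_strict_left_mono)
        finally have "dist (\<gamma> t) (x p) < r"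
          using elim(3) dist_triangle[of "\<gamma> t" "x p" "X k t"] by (simp add: dist_commute)
        then show "c' \<le> w \<bullet> v p"
          using r(2) v_in by simp
      qed (use t h elim elapsed_nonneg[of "i k"] in auto)
      then show ?case by simp
    qed
    moreover have "(\<lambda>k. w \<bullet> (X k t - X k (t + h))) \<longlonglongrightarrow> w \<bullet> (\<gamma> t - \<gamma> (t + h))"
      using lt lim[of "t + h"] t h by (intro tendsto_intros) (auto simp: X_def)
    ultimately show ?thesis
      by (intro tendsto_lowerbound) auto
  qed
  have "((\<lambda>t. w \<bullet> \<gamma> t) has_real_derivative w \<bullet> d) (at t)"
    using bounded_linear.has_vector_derivative[OF bounded_linear_inner_right d]
    by (simp add: has_real_derivative_iff_has_vector_derivative)
  then have "((\<lambda>h. (w \<bullet> \<gamma> (t + h) - w \<bullet> \<gamma> t) / h) \<longlongrightarrow> w \<bullet> d) (at 0)"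
    by (simp add: DERIV_def)
  then have "((\<lambda>h. (w \<bullet> \<gamma> (t + h) - w \<bullet> \<gamma> t) / h) \<longlongrightarrow> w \<bullet> d) (at_right 0)"
    by (simp add: filterlim_at_split)
  moreover have "\<forall>\<^sub>F h in at_right 0. (w \<bullet> \<gamma> (t + h) - w \<bullet> \<gamma> t) / h \<le> - c'"
  proof (rule eventually_at_rightI)
    show "0 < min \<delta> (\<tau> - t)" using \<delta> t by simp
    fix h assume "h \<in> {0<..<min \<delta> (\<tau> - t)}"
    then show "(w \<bullet> \<gamma> (t + h) - w \<bullet> \<gamma> t) / h \<le> - c'"
      using step[of h] by (simp add: divide_le_eq inner_diff_right)
  qed
  ultimately have "w \<bullet> d \<le> - c'"
    by (rule tendsto_upperbound) simp
  with c' show False by simp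
qed

text \<open>Compactness: violating windows with start indices tending to infinity would, by
  Arzela-Ascoli and convergence of their durations along a subsequence, yield a limit curve that
  obeys \<open>subgradient_curve_descent\<close> yet still misses it by
  \<open>\<eta>\<close>.\<close>

lemma descent:
  assumes T: "0 \<le> T" and \<eta>: "0 < \<eta>"
  shows "\<exists>N. \<forall>i j. N \<le> i \<longrightarrow> i \<le> j \<longrightarrow> elapsed j - elapsed i \<le> T \<longrightarrow>
    (norm (x j - x i))\<^sup>2 \<le> T * (f (x i) - f (x j)) + \<eta>"
proof (rule ccontr)
  assume "\<not> ?thesis"
  then obtain i j where ij: "\<And>k. k \<le> i k" "\<And>k. i k \<le> j k"
    "\<And>k. elapsed (j k) - elapsed (i k) \<le> T"
    and big: "\<And>k. T * (f (x (i k)) - f (x (j k))) + \<eta> < (norm (x (j k) - x (i k)))\<^sup>2"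
    unfolding not_ex not_all not_imp not_le by metis
  define D where "D = (\<lambda>k. elapsed (j k) - elapsed (i k))"
  have D: "0 \<le> D k" "D k \<le> T" for k
    using ij elapsed_le[of "i k" "j k"] by (auto simp: D_def)
  define X where "X = (\<lambda>k s. interp (j k) (elapsed (i k) + s))"
  have X0: "X k 0 = x (i k)" and XD: "X k (D k) = x (j k)" for k
    using ij(2) by (simp_all add: X_def D_def interp_elapsed)
  have X_lip: "norm (X k s - X k t) \<le> speed * \<bar>s - t\<bar>" for k s t
    using lipschitz_on_normD[OF interp_lipschitz, of "elapsed (i k) + s" "elapsed (i k) + t" "j k"]
    by (simp add: X_def)
  obtain B where B: "\<And>n. norm (x n) \<le> B"
    using bounded_x by (auto simp: bounded_iff)
  obtain g k1 where k1: "strict_mono (k1 :: nat \<Rightarrow> nat)"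
    and g: "\<And>e. 0 < e \<Longrightarrow> \<exists>N. \<forall>n s. n \<ge> N \<and> s \<in> {0..T} \<longrightarrow> norm (X (k1 n) s - g s) < e"
  proof (rule Arzela_Ascoli[of "{0..T}" X "B + speed * T"])
    fix n s assume s: "s \<in> {0..T}"
    have "norm (X n s) \<le> norm (X n 0) + norm (X n s - X n 0)"
      by (metis add_diff_cancel_left' diff_add_cancel norm_triangle_ineq add.commute)
    moreover have "speed * \<bar>s - 0\<bar> \<le> speed * T"
      using s speed(1) by simp
    moreover have "norm (X n 0) \<le> B" by (simp add: X0 B)
    ultimately show "norm (X n s) \<le> B + speed * T"
      using X_lip[of n s 0] by linarith
  next
    fix s e :: real assume "0 < e"
    then have "norm (X n s - X n t) < e" if "norm (s - t) < e / speed" for n t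
      using X_lip[of n s t] that speed(1) by (simp add: pos_less_divide_eq mult.commute)
    with \<open>0 < e\<close> speed(1)
    show "\<exists>d>0. \<forall>n t. t \<in> {0..T} \<and> norm (s - t) < d \<longrightarrow> norm (X n s - X n t) < e"
      by (intro exI[of _ "e / speed"]) auto
  qed auto
  have "bounded (range (D \<circ> k1))"
    using D by (auto simp: bounded_iff intro!: exI[of _ T])
  then obtain \<tau> k2 where k2: "strict_mono (k2 :: nat \<Rightarrow> nat)" and \<tau>': "((D \<circ> k1) \<circ> k2) \<longlonglongrightarrow> \<tau>"
    using bounded_imp_convergent_subsequence by blast
  define k where "k = k1 \<circ> k2"
  have k: "strict_mono k" using k1 k2 by (simp add: k_def strict_mono_o)
  have \<tau>: "(\<lambda>n. D (k n)) \<longlonglongrightarrow> \<tau>" using \<tau>' by (simp add: k_def o_def)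
  have \<tau>T: "0 \<le> \<tau>" "\<tau> \<le> T"
    using D by (auto intro!: tendsto_lowerbound[OF \<tau>] tendsto_upperbound[OF \<tau>])
  have lim: "(\<lambda>n. X (k n) s) \<longlonglongrightarrow> g s" if "s \<in> {0..T}" for s
  proof -
    have "(\<lambda>n. X (k1 n) s) \<longlonglongrightarrow> g s"
      unfolding LIMSEQ_iff using g that by blast
    from LIMSEQ_subseq_LIMSEQ[OF this k2] show ?thesis
      by (simp add: k_def o_def)
  qed
  \<comment> \<open>Clamping the time extends the limit from \<open>{0..T}\<close> to a Lipschitz
    curve on the line, as path differentiability requires.\<close>
  define \<gamma> where "\<gamma> = (\<lambda>s. g (max 0 (min s T)))"
  have \<gamma>_eq: "\<gamma> s = g s" if "s \<in> {0..T}" for s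
    using that by (simp add: \<gamma>_def)
  have g_lip: "norm (g s - g t) \<le> speed * \<bar>s - t\<bar>" if "s \<in> {0..T}" "t \<in> {0..T}" for s t
    by (rule tendsto_upperbound[OF tendsto_norm[OF tendsto_diff[OF lim[OF that(1)] lim[OF that(2)]]]])
      (use X_lip in auto)
  have \<gamma>_lip: "speed-lipschitz_on UNIV \<gamma>"
  proof (rule lipschitz_onI)
    fix s t :: real
    have "dist (\<gamma> s) (\<gamma> t) \<le> speed * \<bar>max 0 (min s T) - max 0 (min t T)\<bar>"
      unfolding \<gamma>_def dist_norm using T by (intro g_lip) auto
    also have "\<dots> \<le> speed * \<bar>s - t\<bar>"
      using speed(1) by (intro mult_left_mono) auto
    finally show "dist (\<gamma> s) (\<gamma> t) \<le> speed * dist s t" by (simp add: dist_real_def)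
  qed (use speed in simp)
  have xi: "(\<lambda>n. x (i (k n))) \<longlonglongrightarrow> \<gamma> 0"
    using lim[of 0] T by (simp add: X0 \<gamma>_eq)
  \<comment> \<open>The end point is read off at the moving time \<open>D (k n)\<close>; the common
    Lipschitz bound allows replacing it by \<open>\<tau>\<close>.\<close>
  have xj: "(\<lambda>n. x (j (k n))) \<longlonglongrightarrow> \<gamma> \<tau>"
  proof -
    have "(\<lambda>n. speed * \<bar>D (k n) - \<tau>\<bar>) \<longlonglongrightarrow> speed * \<bar>\<tau> - \<tau>\<bar>"
      by (intro tendsto_intros \<tau>)
    then have "(\<lambda>n. speed * \<bar>D (k n) - \<tau>\<bar>) \<longlonglongrightarrow> 0" by simp
    then have "(\<lambda>n. X (k n) (D (k n)) - X (k n) \<tau>) \<longlonglongrightarrow> 0"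
      by (rule Lim_null_comparison[OF always_eventually, rotated]) (intro allI X_lip)
    from tendsto_add[OF this lim[of \<tau>]] show ?thesis
      using \<tau>T by (simp add: XD \<gamma>_eq)
  qed
  have "filterlim (\<lambda>n. i (k n)) at_top sequentially"
    by (rule filterlim_at_top_mono[OF filterlim_ident])
      (use ij(1) seq_suble[OF k] in \<open>auto intro!: always_eventually intro: order_trans\<close>)
  then have "- d \<in> clarke_subdifferential f (\<gamma> t)"
    if "0 < t" "t < \<tau>" "(\<gamma> has_vector_derivative d) (at t)" for t d
    using limit_curve_velocity[of "\<lambda>n. i (k n)" "\<lambda>n. j (k n)" \<tau> \<gamma> t d] \<tau> lim \<tau>T that
    by (auto simp: D_def X_def \<gamma>_eq)
  then have "(norm (\<gamma> \<tau> - \<gamma> 0))\<^sup>2 \<le> \<tau> * (f (\<gamma> 0) - f (\<gamma> \<tau>))"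
    by (rule subgradient_curve_descent[OF f_lipschitz f_path_diff \<gamma>_lip \<tau>T(1)])
  \<comment> \<open>Enlarging \<open>\<tau>\<close> to \<open>T\<close> needs a nonnegative drop of
    \<open>f\<close>. The curve inequality gives it for \<open>\<tau> > 0\<close>; for
    \<open>\<tau> = 0\<close> the drop is zero.\<close>
  moreover have "\<tau> * (f (\<gamma> 0) - f (\<gamma> \<tau>)) \<le> T * (f (\<gamma> 0) - f (\<gamma> \<tau>))"
  proof (cases "\<tau> = 0")
    case False
    with \<tau>T calculation have "0 \<le> f (\<gamma> 0) - f (\<gamma> \<tau>)"
      by (smt (verit) zero_le_power2 zero_le_mult_iff)
    with \<tau>T show ?thesis by (simp add: mult_right_mono)
  qed simp
  moreover have "T * (f (\<gamma> 0) - f (\<gamma> \<tau>)) + \<eta> \<le> (norm (\<gamma> \<tau> - \<gamma> 0))\<^sup>2"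
  proof (rule tendsto_le[OF sequentially_bot])
    show "(\<lambda>n. (norm (x (j (k n)) - x (i (k n))))\<^sup>2) \<longlonglongrightarrow> (norm (\<gamma> \<tau> - \<gamma> 0))\<^sup>2"
      by (intro tendsto_intros xi xj)
    show "(\<lambda>n. T * (f (x (i (k n))) - f (x (j (k n)))) + \<eta>) \<longlonglongrightarrow> T * (f (\<gamma> 0) - f (\<gamma> \<tau>)) + \<eta>"
      by (intro tendsto_intros isCont_tendsto_compose[OF locally_lipschitz_isCont[OF f_lipschitz]] xi xj)
  qed (use big in \<open>auto intro!: always_eventually less_imp_le\<close>)
  ultimately show False using \<eta> by linarith
qed

section \<open>Lengthy separations\<close>

lemma elapsed_at_top: "filterlim elapsed at_top sequentially"
proof -
  have "filterlim (\<lambda>n. elapsed (Suc n)) at_top sequentially"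
    using steps by (simp add: step_sizes_def elapsed_def lessThan_Suc_atMost)
  then show ?thesis by (simp add: filterlim_sequentially_Suc)
qed

text \<open>If the elapsed time stayed at most \<open>T\<close> infinitely often,
  \<open>descent\<close> would bound the squared distance of \<open>a\<close> and \<open>b\<close>
  in the limit by \<open>T * (f a - f b) + \<eta> \<le> \<eta>\<close>, and \<open>\<eta>\<close> is
  half that squared distance.\<close>

lemma lengthy_separations:
  assumes ab: "a \<noteq> b" "f a \<le> f b" and r: "filterlim r at_top sequentially"
    and xr: "(\<lambda>k. x (r k)) \<longlonglongrightarrow> a" and rs: "\<And>k. r k \<le> s k" and xs: "(\<lambda>k. x (s k)) \<longlonglongrightarrow> b"
  shows "filterlim (\<lambda>k. elapsed (s k) - elapsed (r k)) at_top sequentially"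
  unfolding filterlim_at_top
proof
  fix Z :: real
  define T where "T = max Z 0"
  define \<eta> where "\<eta> = (norm (b - a))\<^sup>2 / 2"
  have \<eta>: "\<eta> > 0" using ab by (simp add: \<eta>_def)
  obtain N where N: "\<And>i j. \<lbrakk>N \<le> i; i \<le> j; elapsed j - elapsed i \<le> T\<rbrakk> \<Longrightarrow>
      (norm (x j - x i))\<^sup>2 \<le> T * (f (x i) - f (x j)) + \<eta>"
    using descent[of T \<eta>] \<eta> by (auto simp: T_def)
  have "(\<lambda>k. T * (f (x (r k)) - f (x (s k))) + \<eta> - (norm (x (s k) - x (r k)))\<^sup>2)
      \<longlonglongrightarrow> T * (f a - f b) + \<eta> - (norm (b - a))\<^sup>2"
    by (intro tendsto_intros isCont_tendsto_compose[OF locally_lipschitz_isCont[OF f_lipschitz]] xr xs)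
  moreover have "T * (f a - f b) + \<eta> - (norm (b - a))\<^sup>2 < 0"
  proof -
    have "T * (f a - f b) \<le> 0"
      using ab by (intro mult_nonneg_nonpos) (auto simp: T_def)
    moreover have "(norm (b - a))\<^sup>2 = 2 * \<eta>" by (simp add: \<eta>_def)
    ultimately show ?thesis using \<eta> by linarith
  qed
  ultimately have "\<forall>\<^sub>F k in sequentially.
      T * (f (x (r k)) - f (x (s k))) + \<eta> - (norm (x (s k) - x (r k)))\<^sup>2 < 0"
    by (rule order_tendstoD)
  moreover have "\<forall>\<^sub>F k in sequentially. N \<le> r k"
    using r by (simp add: filterlim_at_top)
  ultimately show "\<forall>\<^sub>F k in sequentially. Z \<le> elapsed (s k) - elapsed (r k)"
  proof eventually_elim
    case (elim k)
    then show ?case using N[of "r k" "s k"] rs[of k] by (force simp: T_def)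
  qed
qed

subsection \<open>Oscillation compensation and criticality\<close>

lemma short_block_bound:
  assumes \<psi>: "continuous_on UNIV \<psi>" "\<And>y. \<psi> y \<in> {0..1}" and \<delta>: "\<delta> > 0"
  shows "\<exists>C\<ge>0. \<exists>N. \<forall>m n. N \<le> m \<longrightarrow> m \<le> n \<longrightarrow> elapsed n - elapsed m \<le> 1 \<longrightarrow>
    norm (\<Sum>p=m..<n. (\<epsilon> p * \<psi> (x p)) *\<^sub>R v p) \<le> \<delta> + C * (f (x m) - f (x n))"
proof -
  define \<delta>1 where "\<delta>1 = \<delta> / (2 * (1 + speed))"
  have \<delta>1: "\<delta>1 > 0" "(1 + speed) * \<delta>1 = \<delta> / 2"
    using \<delta> speed(1) by (auto simp: \<delta>1_def field_simps)
  have "compact (closure (range x))" using bounded_x by simp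
  then have "uniformly_continuous_on (closure (range x)) \<psi>"
    using \<psi>(1) by (intro compact_uniformly_continuous) (auto intro: continuous_on_subset)
  then obtain \<rho> where \<rho>: "\<rho> > 0"
    "\<And>p q. norm (x p - x q) < \<rho> \<Longrightarrow> \<bar>\<psi> (x p) - \<psi> (x q)\<bar> < \<delta>1"
    unfolding uniformly_continuous_on_def dist_norm real_norm_def
    using \<delta>1(1) closure_subset by (metis rangeI subsetD)
  \<comment> \<open>Beyond distance \<open>\<rho>\<close> the quadratic term is at least 1 and
    dominates the oscillation of a function with values in \<open>{0..1}\<close>.\<close>
  have \<psi>_close: "\<bar>\<psi> (x p) - \<psi> (x q)\<bar> \<le> \<delta>1 + (norm (x p - x q))\<^sup>2 / \<rho>\<^sup>2" for p q
  proof (cases "norm (x p - x q) < \<rho>")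
    case True
    then show ?thesis using \<rho>(2)[OF True] by (smt (verit) zero_le_divide_iff zero_le_power2)
  next
    case False
    then have "1 \<le> (norm (x p - x q))\<^sup>2 / \<rho>\<^sup>2"
      using \<rho>(1) by (simp add: power_mono)
    moreover have "\<bar>\<psi> (x p) - \<psi> (x q)\<bar> \<le> 1"
      using \<psi>(2)[of "x p"] \<psi>(2)[of "x q"] by auto
    ultimately show ?thesis using \<delta>1(1) by linarith
  qed
  \<comment> \<open>\<open>descent\<close> controls only squared displacements, so the linear one is
    traded for a square plus \<open>\<delta>1\<close>.\<close>
  have norm_le: "norm z \<le> \<delta>1 + (norm z)\<^sup>2 / \<delta>1" for z :: 'a
  proof (cases "norm z \<le> \<delta>1")
    case False
    then have "norm z * \<delta>1 \<le> (norm z)\<^sup>2"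
      by (simp add: power2_eq_square mult_left_mono)
    then show ?thesis using \<delta>1(1) by (simp add: field_simps add_increasing)
  qed (use \<delta>1 in \<open>simp add: add_increasing2\<close>)
  define C where "C = 1 / \<delta>1 + speed / \<rho>\<^sup>2"
  have C: "C > 0" using \<delta>1 \<rho> speed(1) by (simp add: C_def add_pos_pos)
  define \<eta> where "\<eta> = \<delta> / (4 * C)"
  have \<eta>: "\<eta> > 0" "C * (2 * \<eta>) = \<delta> / 2" using C \<delta> by (auto simp: \<eta>_def)
  obtain N where N: "\<And>i j. \<lbrakk>N \<le> i; i \<le> j; elapsed j - elapsed i \<le> 1\<rbrakk> \<Longrightarrow>
      (norm (x j - x i))\<^sup>2 \<le> 1 * (f (x i) - f (x j)) + \<eta>"
    using descent[of 1 \<eta>] \<eta>(1) by auto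
  have "norm (\<Sum>p=m..<n. (\<epsilon> p * \<psi> (x p)) *\<^sub>R v p) \<le> \<delta> + C * (f (x m) - f (x n))"
    if mn: "N \<le> m" "m \<le> n" "elapsed n - elapsed m \<le> 1" for m n
  proof -
    \<comment> \<open>Two errors \<open>\<eta>\<close>: \<open>descent\<close> from \<open>m\<close>
      to \<open>p\<close> produces \<open>f (x p)\<close>, and \<open>descent\<close> from
      \<open>p\<close> to \<open>n\<close> shows that \<open>f (x p)\<close> is at least
      \<open>f (x n) - \<eta>\<close>.\<close>
    define Q where "Q = f (x m) - f (x n) + 2 * \<eta>"
    have Q: "(norm (x p - x m))\<^sup>2 \<le> Q" if p: "m \<le> p" "p \<le> n" for p
    proof -
      have "elapsed p - elapsed m \<le> 1" "elapsed n - elapsed p \<le> 1"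
        using mn elapsed_le[OF p(1)] elapsed_le[OF p(2)] by linarith+
      then show ?thesis
        using N[OF mn(1) p(1)] N[of p n] p mn zero_le_power2[of "norm (x n - x p)"]
        unfolding Q_def by (smt (verit) order_trans)
    qed
    have "(\<Sum>p=m..<n. \<epsilon> p *\<^sub>R v p) = x m - x n"
      using mn(2) by (induction n rule: dec_induct) (auto simp: x_Suc)
    then have "\<psi> (x m) *\<^sub>R (x m - x n) = (\<Sum>p=m..<n. (\<epsilon> p * \<psi> (x m)) *\<^sub>R v p)"
      by (simp add: scaleR_sum_right mult.commute flip: \<open>_ = x m - x n\<close>)
    moreover have "(\<Sum>p=m..<n. (\<epsilon> p * \<psi> (x p)) *\<^sub>R v p) = (\<Sum>p=m..<n. (\<epsilon> p * \<psi> (x m)) *\<^sub>R v p)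
        + (\<Sum>p=m..<n. (\<epsilon> p * (\<psi> (x p) - \<psi> (x m))) *\<^sub>R v p)"
      unfolding sum.distrib[symmetric] by (rule sum.cong) (simp_all add: algebra_simps)
    ultimately have split: "(\<Sum>p=m..<n. (\<epsilon> p * \<psi> (x p)) *\<^sub>R v p) = \<psi> (x m) *\<^sub>R (x m - x n)
        + (\<Sum>p=m..<n. (\<epsilon> p * (\<psi> (x p) - \<psi> (x m))) *\<^sub>R v p)"
      by simp
    have main: "norm (\<psi> (x m) *\<^sub>R (x m - x n)) \<le> \<delta>1 + Q / \<delta>1"
    proof -
      have "norm (\<psi> (x m) *\<^sub>R (x m - x n)) \<le> norm (x n - x m)"
        using \<psi>(2)[of "x m"] by (simp add: norm_minus_commute mult_left_le_one_le)
      also have "\<dots> \<le> \<delta>1 + (norm (x n - x m))\<^sup>2 / \<delta>1" by (rule norm_le)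
      also have "\<dots> \<le> \<delta>1 + Q / \<delta>1"
        using Q[of n] mn \<delta>1(1) by (simp add: divide_right_mono)
      finally show ?thesis .
    qed
    have error: "norm (\<Sum>p=m..<n. (\<epsilon> p * (\<psi> (x p) - \<psi> (x m))) *\<^sub>R v p) \<le> (\<delta>1 + Q / \<rho>\<^sup>2) * speed"
    proof -
      have bd: "0 \<le> \<delta>1 + Q / \<rho>\<^sup>2"
        using Q[of m] mn \<delta>1(1) by (simp add: add_nonneg_nonneg)
      have "norm (\<Sum>p=m..<n. (\<epsilon> p * (\<psi> (x p) - \<psi> (x m))) *\<^sub>R v p)
          \<le> (\<Sum>p=m..<n. \<epsilon> p * ((\<delta>1 + Q / \<rho>\<^sup>2) * speed))"
      proof (rule sum_norm_le)
        fix p assume p: "p \<in> {m..<n}"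
        have "\<bar>\<psi> (x p) - \<psi> (x m)\<bar> \<le> \<delta>1 + (norm (x p - x m))\<^sup>2 / \<rho>\<^sup>2"
          by (rule \<psi>_close)
        also have "\<dots> \<le> \<delta>1 + Q / \<rho>\<^sup>2"
          using Q[of p] p by (simp add: divide_right_mono)
        finally have "\<bar>\<psi> (x p) - \<psi> (x m)\<bar> * norm (v p) \<le> (\<delta>1 + Q / \<rho>\<^sup>2) * speed"
          using speed(2)[of p] by (intro mult_mono) auto
        then show "norm ((\<epsilon> p * (\<psi> (x p) - \<psi> (x m))) *\<^sub>R v p) \<le> \<epsilon> p * ((\<delta>1 + Q / \<rho>\<^sup>2) * speed)"
          using step_pos[of p] by (simp add: abs_mult mult.assoc)
      qed
      also have "\<dots> = (elapsed n - elapsed m) * ((\<delta>1 + Q / \<rho>\<^sup>2) * speed)"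
        unfolding sum_distrib_right[symmetric] elapsed_diff[OF mn(2)] ..
      also have "\<dots> \<le> 1 * ((\<delta>1 + Q / \<rho>\<^sup>2) * speed)"
        using mn(3) bd speed(1) by (intro mult_right_mono) auto
      finally show ?thesis by simp
    qed
    have "norm (\<Sum>p=m..<n. (\<epsilon> p * \<psi> (x p)) *\<^sub>R v p)
        \<le> \<delta>1 + Q / \<delta>1 + (\<delta>1 + Q / \<rho>\<^sup>2) * speed"
      unfolding split by (rule norm_triangle_mono[OF main error])
    also have "\<dots> = (1 + speed) * \<delta>1 + C * Q"
      by (simp add: C_def algebra_simps)
    also have "\<dots> = \<delta> + C * (f (x m) - f (x n))"
      using \<delta>1(2) \<eta>(2) by (simp add: Q_def algebra_simps)
    finally show ?thesis .
  qed
  with C show ?thesis by (intro exI[of _ C]) auto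
qed

text \<open>Split off blocks of length between 1/2 and 1. The error \<open>\<delta> / 2\<close> of
  each is paid for by its length, except for the last block, which uses the extra 1; the drops of
  \<open>f\<close> telescope because all blocks share \<open>C\<close>.\<close>

lemma long_block_bound:
  assumes \<psi>: "continuous_on UNIV \<psi>" "\<And>y. \<psi> y \<in> {0..1}" and \<delta>: "\<delta> > 0"
  shows "\<exists>C\<ge>0. \<exists>N. \<forall>m n. N \<le> m \<longrightarrow> m \<le> n \<longrightarrow>
    norm (\<Sum>p=m..<n. (\<epsilon> p * \<psi> (x p)) *\<^sub>R v p)
      \<le> \<delta> * (elapsed n - elapsed m + 1) + C * (f (x m) - f (x n))"
proof -
  obtain C N where C: "C \<ge> 0" and short: "\<And>m n. \<lbrakk>N \<le> m; m \<le> n; elapsed n - elapsed m \<le> 1\<rbrakk> \<Longrightarrow>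
    norm (\<Sum>p=m..<n. (\<epsilon> p * \<psi> (x p)) *\<^sub>R v p) \<le> \<delta> / 2 + C * (f (x m) - f (x n))"
    using short_block_bound[OF \<psi>, of "\<delta> / 2"] \<delta> by auto
  obtain N' where N': "\<And>i. N' \<le> i \<Longrightarrow> \<epsilon> i < 1 / 2"
    using order_tendstoD(2)[OF step_tendsto, of "1 / 2"] by (auto simp: eventually_sequentially)
  have "norm (\<Sum>p=m..<n. (\<epsilon> p * \<psi> (x p)) *\<^sub>R v p)
      \<le> \<delta> * (elapsed n - elapsed m + 1) + C * (f (x m) - f (x n))"
    if "max N N' \<le> m" "m \<le> n" for m n
    using that
  proof (induction "n - m" arbitrary: m rule: less_induct)
    case less
    show ?case
    proof (cases "elapsed n - elapsed m \<le> 1")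
      case True
      have "\<delta> / 2 \<le> \<delta> * (elapsed n - elapsed m + 1)"
        using \<delta> elapsed_le[OF less.prems(2)] by simp
      then show ?thesis using short[OF _ less.prems(2) True] less.prems(1) by simp
    next
      case False
      \<comment> \<open>The first index past time 1/2: late steps are shorter than 1/2, so the block
        ending at \<open>q\<close> has length at most 1.\<close>
      define q where "q = (LEAST q. 1 / 2 < elapsed q - elapsed m)"
      have n: "1 / 2 < elapsed n - elapsed m" using False by simp
      have q: "1 / 2 < elapsed q - elapsed m" and qn: "q \<le> n"
        unfolding q_def by (rule LeastI[of "\<lambda>q. 1 / 2 < elapsed q - elapsed m", OF n])
          (rule Least_le[of "\<lambda>q. 1 / 2 < elapsed q - elapsed m", OF n])
      have mq: "m < q"
        using q elapsed_le[of q m] by (cases "m < q") auto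
      then obtain q' where q': "q = Suc q'" "m \<le> q'" by (cases q) auto
      have "elapsed q' - elapsed m \<le> 1 / 2"
        using not_less_Least[of q' "\<lambda>q. 1 / 2 < elapsed q - elapsed m"] q' by (simp add: q_def)
      then have q1: "elapsed q - elapsed m \<le> 1"
        using N'[of q'] q' less.prems(1) by (simp add: elapsed_Suc)
      have "norm (\<Sum>p=m..<q. (\<epsilon> p * \<psi> (x p)) *\<^sub>R v p) \<le> \<delta> / 2 + C * (f (x m) - f (x q))"
        using short[of m q] mq q1 less.prems(1) by simp
      also have "\<dots> \<le> \<delta> * (elapsed q - elapsed m) + C * (f (x m) - f (x q))"
        using q \<delta> by simp
      finally have 1: "norm (\<Sum>p=m..<q. (\<epsilon> p * \<psi> (x p)) *\<^sub>R v p) \<le> \<dots>" .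
      have 2: "norm (\<Sum>p=q..<n. (\<epsilon> p * \<psi> (x p)) *\<^sub>R v p)
          \<le> \<delta> * (elapsed n - elapsed q + 1) + C * (f (x q) - f (x n))"
        using less.hyps[of q] mq qn less.prems by simp
      have "(\<Sum>p=m..<n. (\<epsilon> p * \<psi> (x p)) *\<^sub>R v p)
          = (\<Sum>p=m..<q. (\<epsilon> p * \<psi> (x p)) *\<^sub>R v p) + (\<Sum>p=q..<n. (\<epsilon> p * \<psi> (x p)) *\<^sub>R v p)"
        using mq qn by (simp add: sum.atLeastLessThan_concat)
      with norm_triangle_mono[OF 1 2] show ?thesis
        by (simp add: algebra_simps)
    qed
  qed
  with C show ?thesis by blast
qed

text \<open>As \<open>f\<close> is bounded on the iterates, \<open>long_block_bound\<close> leaves a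
  constant \<open>A\<close> plus \<open>e / 2 * elapsed n\<close>, and the constant is negligible
  against the diverging elapsed time.\<close>

lemma weighted_average_tendsto_0:
  assumes \<psi>: "continuous_on UNIV \<psi>" "\<And>y. \<psi> y \<in> {0..1}"
  shows "(\<lambda>n. (\<Sum>p<n. (\<epsilon> p * \<psi> (x p)) *\<^sub>R v p) /\<^sub>R elapsed n) \<longlonglongrightarrow> 0"
proof (rule tendstoI)
  fix e :: real assume e: "e > 0"
  define S where "S = (\<lambda>n. \<Sum>p<n. (\<epsilon> p * \<psi> (x p)) *\<^sub>R v p)"
  obtain C N where C: "C \<ge> 0" and long: "\<And>m n. \<lbrakk>N \<le> m; m \<le> n\<rbrakk> \<Longrightarrow>
    norm (\<Sum>p=m..<n. (\<epsilon> p * \<psi> (x p)) *\<^sub>R v p)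
      \<le> e / 2 * (elapsed n - elapsed m + 1) + C * (f (x m) - f (x n))"
    using long_block_bound[OF \<psi>, of "e / 2"] e by auto
  have "compact (f ` closure (range x))"
    using bounded_x locally_lipschitz_isCont[OF f_lipschitz]
    by (intro compact_continuous_image continuous_at_imp_continuous_on) auto
  then have "bounded (f ` range x)"
    using bounded_subset[OF compact_imp_bounded image_mono[OF closure_subset]] by blast
  then obtain M where M: "\<And>n. \<bar>f (x n)\<bar> \<le> M"
    by (auto simp: bounded_iff)
  define A where "A = norm (S N) + e / 2 + C * (2 * M)"
  have "\<forall>\<^sub>F n in sequentially. max 1 (2 * A / e + 1) \<le> elapsed n"
    using elapsed_at_top unfolding filterlim_at_top by blast
  moreover have "\<forall>\<^sub>F n in sequentially. N \<le> n" by (rule eventually_ge_at_top)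
  ultimately show "\<forall>\<^sub>F n in sequentially. dist (S n /\<^sub>R elapsed n) 0 < e"
  proof eventually_elim
    case (elim n)
    have "S n = S N + (\<Sum>p=N..<n. (\<epsilon> p * \<psi> (x p)) *\<^sub>R v p)"
      unfolding S_def lessThan_atLeast0 using elim by (simp add: sum.atLeastLessThan_concat)
    then have "norm (S n) \<le> norm (S N) + (e / 2 * (elapsed n - elapsed N + 1) + C * (f (x N) - f (x n)))"
      using norm_triangle_mono[OF order_refl long[of N n]] elim by simp
    moreover have "C * (f (x N) - f (x n)) \<le> C * (2 * M)"
      using C M[of N] M[of n] by (intro mult_left_mono) auto
    moreover have "e / 2 * (elapsed n - elapsed N + 1) \<le> e / 2 * elapsed n + e / 2"
      using e elapsed_nonneg[of N] by (simp add: algebra_simps)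
    ultimately have "norm (S n) \<le> e / 2 * elapsed n + A"
      unfolding A_def by linarith
    moreover have "A < e / 2 * elapsed n"
      using elim e by (simp add: field_simps)
    ultimately have "norm (S n) < e * elapsed n" by simp
    then show ?case using elim by (simp add: inverse_eq_divide pos_divide_less_eq)
  qed
qed

text \<open>The positive lower limit provides \<open>c > 0\<close> with
  \<open>c * elapsed (N j) \<le> P (N j)\<close> eventually, so changing the denominator costs only
  a factor \<open>1 / c\<close>.\<close>

lemma oscillation_compensation:
  assumes \<psi>: "continuous_on UNIV \<psi>" "\<And>y. \<psi> y \<in> {0..1}"
    and N: "filterlim N at_top sequentially"
    and pos: "0 < liminf (\<lambda>j. ereal ((\<Sum>i<N j. \<epsilon> i * \<psi> (x i)) / elapsed (N j)))"
  shows "(\<lambda>j. (\<Sum>i<N j. (\<epsilon> i * \<psi> (x i)) *\<^sub>R v i) /\<^sub>R (\<Sum>i<N j. \<epsilon> i * \<psi> (x i))) \<longlonglongrightarrow> 0"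
proof -
  define S P where "S = (\<lambda>n. \<Sum>p<n. (\<epsilon> p * \<psi> (x p)) *\<^sub>R v p)" and "P = (\<lambda>n. \<Sum>i<n. \<epsilon> i * \<psi> (x i))"
  obtain c where c: "0 < ereal c" "ereal c < liminf (\<lambda>j. ereal (P (N j) / elapsed (N j)))"
    using ereal_dense2[OF pos] unfolding P_def by blast
  have lim: "(\<lambda>j. S (N j) /\<^sub>R elapsed (N j)) \<longlonglongrightarrow> 0"
    using filterlim_compose[OF weighted_average_tendsto_0[OF \<psi>] N] by (simp add: S_def)
  have "(\<lambda>j. S (N j) /\<^sub>R P (N j)) \<longlonglongrightarrow> 0"
  proof (rule Lim_null_comparison)
    show "(\<lambda>j. norm (S (N j) /\<^sub>R elapsed (N j)) / c) \<longlonglongrightarrow> 0"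
      using tendsto_divide[OF tendsto_norm[OF lim] tendsto_const, of c] c by simp
    have "\<forall>\<^sub>F j in sequentially. c < P (N j) / elapsed (N j)"
      using less_LiminfD[OF c(2)] by simp
    then show "\<forall>\<^sub>F j in sequentially. norm (S (N j) /\<^sub>R P (N j)) \<le> norm (S (N j) /\<^sub>R elapsed (N j)) / c"
    proof eventually_elim
      case (elim j)
      have el: "elapsed (N j) > 0"
        using elim c elapsed_nonneg[of "N j"] by (cases "elapsed (N j) = 0") auto
      then have "c * elapsed (N j) \<le> P (N j)" using elim by (simp add: pos_less_divide_eq)
      moreover have "0 < c * elapsed (N j)" using c el by simp
      ultimately have "norm (S (N j)) / P (N j) \<le> norm (S (N j)) / (c * elapsed (N j))"
        by (intro divide_left_mono) auto
      moreover have "0 < P (N j)" using \<open>c * elapsed (N j) \<le> P (N j)\<close> \<open>0 < c * elapsed (N j)\<close> by linarith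
      ultimately show ?case using el by (simp add: divide_inverse mult_ac)
    qed
  qed
  then show ?thesis by (simp add: S_def P_def)
qed

text \<open>At a noncritical \<open>a\<close> some \<open>w\<close> has \<open>w \<bullet> u\<close>
  bounded below by \<open>b / 2\<close> for all subgradients near \<open>a\<close>. The
  \<open>w\<close>-component of the bump-weighted average is then at least \<open>b / 2\<close>
  times the fraction of time spent close to \<open>a\<close>. As the average vanishes in the limit,
  so does that fraction.\<close>

lemma ess_acc_subset_crit: "ess_acc \<epsilon> x \<subseteq> crit f"
proof
  fix a assume a: "a \<in> ess_acc \<epsilon> x"
  show "a \<in> crit f"
  proof (rule ccontr)
    assume "a \<notin> crit f"
    then obtain w b where b: "0 < b" "\<And>u. u \<in> clarke_subdifferential f a \<Longrightarrow> b < w \<bullet> u"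
      using separating_hyperplane_closed_0[OF convex_clarke closed_clarke] unfolding crit_def by blast
    have "b / 2 < b" using b(1) by simp
    then obtain r where r: "r > 0"
      "\<And>y u. \<lbrakk>y \<in> ball a r; u \<in> clarke_subdifferential f y\<rbrakk> \<Longrightarrow> b / 2 \<le> w \<bullet> u"
      using clarke_halfspace_usc[OF f_lipschitz less_imp_le[OF b(2)]] by blast
    \<comment> \<open>A tent equal to 1 on the ball of radius \<open>r / 2\<close> and to 0 outside
      radius \<open>r\<close>: the half-space bound, multiplied by \<open>\<psi>\<close>, holds at
      every iterate.\<close>
    define \<psi> where "\<psi> = (\<lambda>y. max 0 (min 1 (2 - 2 * dist a y / r)))"
    have \<psi>: "continuous_on UNIV \<psi>" "\<And>y. \<psi> y \<in> {0..1}"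
    proof -
      show "continuous_on UNIV \<psi>"
        unfolding \<psi>_def using r(1) by (intro continuous_intros) simp
    qed (simp add: \<psi>_def)
    have \<psi>1: "\<psi> y = 1" if "y \<in> ball a (r / 2)" for y
      using that r(1) by (simp add: \<psi>_def field_simps)
    have \<psi>v: "b / 2 * \<psi> (x p) \<le> \<psi> (x p) * (w \<bullet> v p)" for p
    proof (cases "x p \<in> ball a r")
      case True
      then show ?thesis
        using mult_left_mono[OF r(2)[OF True v_in], of "\<psi> (x p)"] \<psi>(2)[of "x p"]
        by (simp add: mult.commute)
    next
      case False
      then have "\<psi> (x p) = 0" using r(1) by (simp add: \<psi>_def field_simps)
      then show ?thesis by simp
    qed
    define S where "S = (\<lambda>n. \<Sum>p<n. (\<epsilon> p * \<psi> (x p)) *\<^sub>R v p)"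
    define A where "A = (\<lambda>N. \<Sum>i | 1 \<le> i \<and> i \<le> N \<and> x i \<in> ball a (r / 2). \<epsilon> i)"
    \<comment> \<open>\<open>A\<close> starts at index 1 and \<open>S\<close> at index 0; the
      additional term has a nonnegative \<open>w\<close>-component.\<close>
    have wS: "b / 2 * A N \<le> w \<bullet> S (Suc N)" for N
    proof -
      have "A N = (\<Sum>i | 1 \<le> i \<and> i \<le> N \<and> x i \<in> ball a (r / 2). \<epsilon> i * \<psi> (x i))"
        unfolding A_def by (rule sum.cong) (auto simp: \<psi>1)
      also have "\<dots> \<le> (\<Sum>i<Suc N. \<epsilon> i * \<psi> (x i))"
        by (rule sum_mono2) (use \<psi>(2) in \<open>auto simp: step_pos less_imp_le\<close>)
      finally have "b / 2 * A N \<le> b / 2 * (\<Sum>i<Suc N. \<epsilon> i * \<psi> (x i))"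
        using b(1) by simp
      also have "\<dots> = (\<Sum>i<Suc N. \<epsilon> i * (b / 2 * \<psi> (x i)))"
        by (simp only: sum_distrib_left mult_ac)
      also have "\<dots> \<le> (\<Sum>i<Suc N. \<epsilon> i * (\<psi> (x i) * (w \<bullet> v i)))"
        by (intro sum_mono mult_left_mono \<psi>v) (use step_pos less_imp_le in auto)
      also have "\<dots> = w \<bullet> S (Suc N)"
        by (simp add: S_def inner_sum_right inner_add_right mult.assoc)
      finally show ?thesis .
    qed
    have "a \<in> interior (ball a (r / 2))" using r(1) by simp
    with a have "0 < limsup (\<lambda>N. ereal (A N / (\<Sum>i=1..N. \<epsilon> i)))"
      unfolding ess_acc_def A_def mem_Collect_eq by (elim allE impE)
    then obtain c where c: "0 < ereal c" "ereal c < limsup (\<lambda>N. ereal (A N / (\<Sum>i=1..N. \<epsilon> i)))"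
      using ereal_dense2 by blast
    have "(\<lambda>n. w \<bullet> (S n /\<^sub>R elapsed n)) \<longlonglongrightarrow> w \<bullet> 0"
      unfolding S_def by (rule tendsto_inner[OF tendsto_const weighted_average_tendsto_0[OF \<psi>]])
    from LIMSEQ_Suc[OF this]
    have "(\<lambda>n. w \<bullet> (S (Suc n) /\<^sub>R elapsed (Suc n))) \<longlonglongrightarrow> 0"
      by (simp only: inner_zero_right)
    \<comment> \<open>Of the 4, one factor 2 cancels against \<open>b / 2\<close>; the other pays
      for dropping \<open>\<epsilon> 0\<close> from the denominator once
      \<open>elapsed (Suc n)\<close> exceeds \<open>2 * \<epsilon> 0\<close>.\<close>
    then have "\<forall>\<^sub>F n in sequentially. w \<bullet> (S (Suc n) /\<^sub>R elapsed (Suc n)) < b * c / 4"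
      by (rule order_tendstoD) (use b c in simp)
    moreover have "\<forall>\<^sub>F n in sequentially. 2 * \<epsilon> 0 + 1 \<le> elapsed (Suc n)"
      using filterlim_compose[OF elapsed_at_top filterlim_Suc] unfolding filterlim_at_top by blast
    ultimately have "\<forall>\<^sub>F N in sequentially. ereal (A N / (\<Sum>i=1..N. \<epsilon> i)) \<le> ereal c"
    proof eventually_elim
      case (elim N)
      have s: "(\<Sum>i=1..N. \<epsilon> i) = elapsed (Suc N) - \<epsilon> 0"
        by (simp add: elapsed_def lessThan_Suc_atMost atMost_atLeast0 sum.atLeast_Suc_atMost)
      have el: "elapsed (Suc N) > 0" using elapsed_less[of 0 "Suc N"] elapsed_nonneg[of 0] by linarith
      have "w \<bullet> S (Suc N) < b * c / 4 * elapsed (Suc N)"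
        using elim(1) el by (simp add: inverse_eq_divide pos_divide_less_eq)
      then have "b / 2 * A N < b / 2 * (c / 2 * elapsed (Suc N))"
        using wS[of N] by (simp add: mult_ac)
      then have "A N < c / 2 * elapsed (Suc N)" using b(1) by (simp only: mult_less_cancel_left_pos half_gt_zero)
      also have "\<dots> \<le> c / 2 * (2 * (\<Sum>i=1..N. \<epsilon> i))"
        using c elim(2) unfolding s by (intro mult_left_mono) auto
      finally show ?case
        using elim(2) step_pos[of 0] unfolding s by (simp add: pos_divide_le_eq algebra_simps)
    qed
    then have "limsup (\<lambda>N. ereal (A N / (\<Sum>i=1..N. \<epsilon> i))) \<le> ereal c"
      by (rule Limsup_bounded)
    with c(2) show False by simp
  qed
qed

end

section \<open>The three assertions, with sums over closed index ranges\<close>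

theorem theorem6:
  fixes f :: "real ^ 'n \<Rightarrow> real"
    and \<epsilon> :: "nat \<Rightarrow> real"
    and v x :: "nat \<Rightarrow> real ^ 'n"
  assumes "locally_lipschitz f"
    and "path_differentiable f"
    and "step_sizes \<epsilon>"
    and "subgradient_sequence f \<epsilon> v x"
    and "bounded (range x)"
  shows "(\<forall>a \<in> ess_acc \<epsilon> x. \<forall>b \<in> ess_acc \<epsilon> x. a \<noteq> b \<longrightarrow> f a \<le> f b \<longrightarrow>
            (\<forall>(r :: nat \<Rightarrow> nat) (s :: nat \<Rightarrow> nat).
               strict_mono r \<longrightarrow> (\<lambda>k. x (r k)) \<longlonglongrightarrow> a \<longrightarrow>
               (\<forall>k. r k < s k) \<longrightarrow> (\<lambda>k. x (s k)) \<longlonglongrightarrow> b \<longrightarrow>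
               filterlim (\<lambda>k. \<Sum>p=r k..s k. \<epsilon> p) at_top sequentially)) \<and>
         (\<forall>\<psi> :: real ^ 'n \<Rightarrow> real.
            continuous_on UNIV \<psi> \<longrightarrow> range \<psi> \<subseteq> {0..1} \<longrightarrow>
            (\<forall>N :: nat \<Rightarrow> nat. strict_mono N \<longrightarrow>
               0 < liminf (\<lambda>j. ereal ((\<Sum>i=0..N j. \<epsilon> i * \<psi> (x i)) / (\<Sum>i=0..N j. \<epsilon> i))) \<longrightarrow>
               (\<lambda>j. (\<Sum>i=0..N j. (\<epsilon> i * \<psi> (x i)) *\<^sub>R v i) /\<^sub>R (\<Sum>i=0..N j. \<epsilon> i * \<psi> (x i)))
                 \<longlonglongrightarrow> 0)) \<and>
         ess_acc \<epsilon> x \<subseteq> crit f"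
proof -
  interpret bounded_subgradient_method f \<epsilon> v x
    using assms by unfold_locales
  have sum0: "(\<Sum>i=0..n. g i) = (\<Sum>i<Suc n. g i)" for n and g :: "nat \<Rightarrow> 'b::comm_monoid_add"
    by (rule sum.cong) auto
  show ?thesis
  proof (intro conjI ballI allI impI)
    fix a b and r s :: "nat \<Rightarrow> nat"
    assume *: "a \<noteq> b" "f a \<le> f b" "strict_mono r" "(\<lambda>k. x (r k)) \<longlonglongrightarrow> a"
      "\<forall>k. r k < s k" "(\<lambda>k. x (s k)) \<longlonglongrightarrow> b"
    have lim: "filterlim (\<lambda>k. elapsed (s k) - elapsed (r k)) at_top sequentially"
      using * by (intro lengthy_separations[of a b] filterlim_subseq) (auto intro: less_imp_le)
    \<comment> \<open>The closed range also contains step \<open>s k\<close>, which only enlarges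
      the sum.\<close>
    have "elapsed (s k) - elapsed (r k) \<le> (\<Sum>p=r k..s k. \<epsilon> p)" for k
    proof -
      have "(\<Sum>p=r k..s k. \<epsilon> p) = elapsed (Suc (s k)) - elapsed (r k)"
        using *(5) elapsed_diff[of "r k" "Suc (s k)"]
        by (simp add: atLeastLessThanSuc_atLeastAtMost le_SucI less_imp_le)
      then show ?thesis using step_pos[of "s k"] by (simp add: elapsed_Suc)
    qed
    then show "filterlim (\<lambda>k. \<Sum>p=r k..s k. \<epsilon> p) at_top sequentially"
      by (intro filterlim_at_top_mono[OF lim] always_eventually allI)
  next
    fix \<psi> :: "real ^ 'n \<Rightarrow> real" and N :: "nat \<Rightarrow> nat"
    assume *: "continuous_on UNIV \<psi>" "range \<psi> \<subseteq> {0..1}" "strict_mono N"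
      and pos: "0 < liminf (\<lambda>j. ereal ((\<Sum>i=0..N j. \<epsilon> i * \<psi> (x i)) / (\<Sum>i=0..N j. \<epsilon> i)))"
    have \<psi>: "\<psi> y \<in> {0..1}" for y using *(2) by blast
    \<comment> \<open>\<open>elapsed\<close> omits its last index, so the sum up to
      \<open>N j\<close> corresponds to \<open>Suc (N j)\<close>.\<close>
    have "filterlim (\<lambda>j. Suc (N j)) at_top sequentially"
      using filterlim_compose[OF filterlim_Suc filterlim_subseq[OF *(3)]] .
    then show "(\<lambda>j. (\<Sum>i=0..N j. (\<epsilon> i * \<psi> (x i)) *\<^sub>R v i) /\<^sub>R (\<Sum>i=0..N j. \<epsilon> i * \<psi> (x i)))
        \<longlonglongrightarrow> 0"
      using pos unfolding sum0 elapsed_def[symmetric]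
      by (rule oscillation_compensation[OF *(1) \<psi>])
  qed (rule ess_acc_subset_crit)
qed

end
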